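(* Let $p$ be a prime and let $m$ be an integer such that type $\langle 2,m\rangle$ occurs. Let $\chi,\psi: U_1\to \mathbb{Z}/p^2\mathbb{Z}$ be continuous characters of type $\langle 2,m\rangle$. Then $\chi$ is weakly equivalent to $\psi$ if and only if $\operatorname{ind}\psi=\operatorname{ind}\chi$.
   Context: $K=\mathbb{F}_p((t))$, $\mathfrak{M}=t\mathbb{F}_p[[t]]$, $U_1=1+\mathfrak{M}$, $U_j=1+\mathfrak{M}^j$. The Nottingham group $\mathfrak{N}$ is the set $\{tz: z\in U_1\}$ of power series under composition. All characters are continuous homomorphisms $U_1\to\mathbb{Z}/p^n\mathbb{Z}$ ($U_1$ with the $t$-adic topology, target discrete). $\mathfrak{N}$ acts by ${}_w\chi(f(t))=\chi(f\circ w(t))$ for $f\in U_1$, $w\in\mathfrak{N}$. Two characters $\chi,\psi$ are weakly equivalent ($\chi\sim\psi$) if $\psi={}_w\chi$ for some $w\in\mathfrak{N}$. For a surjective character $\chi:U_1\to\mathbb{Z}/p^n\mathbb{Z}$, its break sequence (type) $\langle b^{(0)},\dots,b^{(n-1)}\rangle$ is defined by: $b^{(j)}$ is the largest integer $b$ for which there is $z\in 1+\mathfrak{M}^b$ with $\chi(z)=p^j$. A character "of type $\langle 2,m\rangle$" is a surjective character $U_1\to\mathbb{Z}/p^2\mathbb{Z}$ with break sequence $\langle 2,m\rangle$ (so $p\ne 2$, $m\ge 2p$, and if $p\mid m$ then $m=2p$). For $j\ge1$, $p\nmid j$, let $E_j=1+t^j$; these form a topological $\mathbb{Z}_p$-basis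 of $U_1$, and $\mathfrak{Z}_j$ denotes the dual character ($\mathfrak{Z}_i(E_j)=\delta_{ij}$). Every character of type $\langle 2,m\rangle$ has a unique standard expansion $\chi=x_1\mathfrak{Z}_1+x_2\mathfrak{Z}_2+\sum_{1\le j\le m,\,p\nmid j} a_j\, p\,\mathfrak{Z}_j$ with $x_1,x_2,a_j\in\{0,\dots,p-1\}$, $x_2\neq0$, and $a_m\ne 0$ if $p\nmid m$ (i.e. $\chi(E_1)=x_1+pa_1$, $\chi(E_2)=x_2+pa_2$, $\chi(E_j)=pa_j$ for $3\le j\le m$, and $\chi(E_j)=0$ for $j>m$). These coefficients are regarded as elements of $\mathbb{F}_p$. The indicator $\operatorname{ind}\chi$ is: if $m\equiv0\pmod p$ (so $m=2p$), $\operatorname{ind}\chi=[x_2,\ \frac{x_1}{x_2}-\frac{a_{m-1}^p}{(m-1)x_2^p}]$; if $m\not\equiv0,1\pmod p$, $\operatorname{ind}\chi=[x_2,\ a_m,\ \frac{x_1}{x_2}-\frac{a_{m-1}}{(m-1)a_m}]$; if $m\equiv1\pmod p$, $\operatorname{ind}\chi=[x_2,a_m]$ (computations in $\mathbb{F}_p$). *)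

theory Defs
  imports
    "HOL-Computational_Algebra.Formal_Power_Series"
    "HOL-Number_Theory.Residues"
    "Berlekamp_Zassenhaus.Finite_Field"
begin

text \<open>
  The prime is \<open>p = CARD('p)\<close> with \<open>'p :: prime_card\<close>, and the field with \<open>p\<close> elements is
  \<open>'p mod_ring\<close>.  All power series involved are integral, so everything happens in
  \<open>'p mod_ring fps\<close>, whose metric in the library induces the \<open>t\<close>-adic topology (\<open>t = fps_X\<close>).
\<close>

text \<open>\<open>U j = 1 + M^j\<close>, where \<open>M\<close> is the ideal generated by \<open>t\<close>.\<close>

definition U :: "nat \<Rightarrow> 'p::prime_card mod_ring fps set" where
  "U j = {f. fps_X ^ j dvd f - 1}"

definition U1_group :: "'p::prime_card mod_ring fps monoid" where
  "U1_group = \<lparr>carrier = U 1, monoid.mult = (*), one = 1\<rparr>"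

text \<open>
  Elements of \<open>\<int>/p^n\<int>\<close> are represented by the integers in \<open>{0..p^n - 1}\<close>.  The topology of
  type \<^typ>\<open>int\<close> is discrete.  Values of a character outside \<open>U 1\<close> are irrelevant.
\<close>

definition character :: "nat \<Rightarrow> ('p::prime_card mod_ring fps \<Rightarrow> int) \<Rightarrow> bool" where
  "character n chi \<longleftrightarrow>
     chi \<in> hom U1_group (add_monoid (residue_ring (int CARD('p) ^ n))) \<and>
     continuous_on (U 1) chi"

definition nottingham :: "'p::prime_card mod_ring fps set" where
  "nottingham = {fps_X * z | z. z \<in> U 1}"

definition nottingham_act ::
    "'p::prime_card mod_ring fps \<Rightarrow> ('p mod_ring fps \<Rightarrow> int) \<Rightarrow> 'p mod_ring fps \<Rightarrow> int" where
  "nottingham_act w chi = (\<lambda>f. chi (fps_compose f w))"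

definition weakly_equivalent ::
    "('p::prime_card mod_ring fps \<Rightarrow> int) \<Rightarrow> ('p mod_ring fps \<Rightarrow> int) \<Rightarrow> bool" where
  "weakly_equivalent chi psi \<longleftrightarrow>
     (\<exists>w\<in>nottingham. \<forall>f\<in>U 1. psi f = nottingham_act w chi f)"

text \<open>
  For a surjective character onto \<open>\<int>/p^n\<int>\<close> and \<open>j < n\<close> the set below is nonempty and, by
  continuity, bounded, so the maximum exists.
\<close>

definition upper_break :: "('p::prime_card mod_ring fps \<Rightarrow> int) \<Rightarrow> nat \<Rightarrow> nat" where
  "upper_break chi j = (GREATEST b. 1 \<le> b \<and> (\<exists>z\<in>U b. chi z = int CARD('p) ^ j))"

definition break_sequence :: "nat \<Rightarrow> ('p::prime_card mod_ring fps \<Rightarrow> int) \<Rightarrow> nat list" where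
  "break_sequence n chi = map (upper_break chi) [0..<n]"

definition of_type :: "nat list \<Rightarrow> ('p::prime_card mod_ring fps \<Rightarrow> int) \<Rightarrow> bool" where
  "of_type bs chi \<longleftrightarrow>
     character (length bs) chi \<and>
     chi ` U 1 = carrier (residue_ring (int CARD('p) ^ length bs)) \<and>
     break_sequence (length bs) chi = bs"

definition E :: "nat \<Rightarrow> 'p::prime_card mod_ring fps" where
  "E j = 1 + fps_X ^ j"

text \<open>
  In the standard expansion
  \<open>chi = x\<^sub>1 Z\<^sub>1 + x\<^sub>2 Z\<^sub>2 + (\<Sum>j. a\<^sub>j p Z\<^sub>j)\<close> of a character of type \<open>[2, m]\<close>, where \<open>Z\<^sub>j\<close> is dual to
  \<open>E j\<close> and all coefficients are in \<open>{0..p - 1}\<close>, evaluation at \<open>E j\<close> gives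
  \<open>chi (E j) = x\<^sub>j + p a\<^sub>j\<close> for \<open>j = 1, 2\<close> and \<open>chi (E j) = p a\<^sub>j\<close> for the other \<open>j \<le> m\<close> prime to \<open>p\<close>.
  So \<open>x\<^sub>j\<close> and \<open>a\<^sub>j\<close> are the two base-\<open>p\<close> digits of \<open>chi (E j) \<in> {0..p^2 - 1}\<close>; they are
  regarded as elements of the prime field.
\<close>

definition coeff_x :: "('p::prime_card mod_ring fps \<Rightarrow> int) \<Rightarrow> nat \<Rightarrow> 'p mod_ring" where
  "coeff_x chi j = of_int (chi (E j) mod int CARD('p))"

definition coeff_a :: "('p::prime_card mod_ring fps \<Rightarrow> int) \<Rightarrow> nat \<Rightarrow> 'p mod_ring" where
  "coeff_a chi j = of_int (chi (E j) div int CARD('p))"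

definition ind :: "('p::prime_card mod_ring fps \<Rightarrow> int) \<Rightarrow> 'p mod_ring list" where
  "ind chi =
     (let p = CARD('p); m = upper_break chi 1; x = coeff_x chi; a = coeff_a chi in
      if m mod p = 0 then
        [x 2, x 1 / x 2 - a (m - 1) ^ p / (of_nat (m - 1) * x 2 ^ p)]
      else if m mod p = 1 then
        [x 2, a m]
      else
        [x 2, a m, x 1 / x 2 - a (m - 1) / (of_nat (m - 1) * a m)])"

end

theory Submission
  imports Defs
begin

unbundle fps_syntax

text \<open>
  The quotient \<open>U j / U (j+1)\<close> is generated by \<open>E j\<close>, and substituting \<open>w = t + c t\<^sup>k\<^sup>+\<^sup>1 + \<dots>\<close>
  turns \<open>E j\<close> into \<open>E j * (1 + j c t\<^sup>j\<^sup>+\<^sup>k + \<dots>)\<close>.  For \<open>k = 1\<close> this leaves \<open>x\<^sub>2\<close> and \<open>a\<^sub>m\<close> unchanged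
  and moves \<open>x\<^sub>1\<close> by \<open>c x\<^sub>2\<close> and \<open>a\<^sub>m\<^sub>-\<^sub>1\<close> by \<open>(m - 1) c a\<^sub>m\<close>, which is why the indicator is invariant.
  Conversely, if the indicators agree, a suitable \<open>c\<close> matches \<open>x\<^sub>1\<close> and with it \<open>a\<^sub>m\<^sub>-\<^sub>1\<close>; substitutions
  with \<open>k = m - s \<ge> 2\<close> then match \<open>a\<^sub>s\<close> for \<open>s = m - 2, \<dots>, 1\<close> in this order without disturbing
  anything already matched.  If \<open>p\<close> divides \<open>s\<close>, no adjustment is needed, because \<open>E s\<close> is the
  \<open>p\<close>-th power of \<open>E (s/p)\<close>.
\<close>

section \<open>One-units and substitutions\<close>

lemma U_iff_ex: "f \<in> U j \<longleftrightarrow> (\<exists>v. f = 1 + fps_X ^ j * v)"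
  unfolding U_def dvd_def by (auto simp: algebra_simps)

lemma U_antimono: "i \<le> j \<Longrightarrow> f \<in> U j \<Longrightarrow> f \<in> U i"
  unfolding U_def using dvd_trans le_imp_power_dvd by blast

lemma one_in_U [simp]: "1 \<in> U j"
  by (simp add: U_def)

lemma U_nth_0: "f \<in> U j \<Longrightarrow> 1 \<le> j \<Longrightarrow> f $ 0 = 1"
  by (auto simp: U_iff_ex)

lemma U_mult: "f \<in> U j \<Longrightarrow> g \<in> U j \<Longrightarrow> f * g \<in> U j"
proof -
  assume "f \<in> U j" "g \<in> U j"
  then have "fps_X ^ j dvd (f - 1) * g + (g - 1)"
    by (simp add: U_def)
  also have "(f - 1) * g + (g - 1) = f * g - 1"
    by (simp add: algebra_simps)
  finally show ?thesis by (simp add: U_def)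
qed

lemma U_power: "f \<in> U j \<Longrightarrow> f ^ n \<in> U j"
  by (induction n) (auto intro: U_mult)

lemma E_in_U [simp]: "E j \<in> U j"
  by (simp add: U_def E_def)

lemma E_in_U': "i \<le> j \<Longrightarrow> E j \<in> U i"
  by (rule U_antimono[OF _ E_in_U])

lemma E_nth_0: "1 \<le> j \<Longrightarrow> E j $ 0 = 1"
  by (rule U_nth_0[OF E_in_U])

text \<open>The cross term \<open>fps_X ^ j * v * u\<close> has zero constant term because
  \<open>1 <= j\<close>, so leading coefficients simply add from factor to factor.\<close>

lemma power_one_plus_X_power_mult:
  fixes v :: "'a::comm_ring_1 fps"
  assumes "1 \<le> j"
  shows "\<exists>u. (1 + fps_X ^ j * v) ^ n = 1 + fps_X ^ j * u \<and> u $ 0 = of_nat n * v $ 0"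
proof (induction n)
  case 0
  show ?case by (intro exI[of _ 0]) simp
next
  case (Suc n)
  then obtain u where u: "(1 + fps_X ^ j * v) ^ n = 1 + fps_X ^ j * u" "u $ 0 = of_nat n * v $ 0"
    by blast
  have "(1 + fps_X ^ j * v) ^ Suc n = 1 + fps_X ^ j * (v + u + fps_X ^ j * v * u)"
    by (simp add: u(1)) (simp add: algebra_simps)
  moreover have "(v + u + fps_X ^ j * v * u) $ 0 = of_nat (Suc n) * v $ 0"
    using assms by (simp add: u algebra_simps fps_mult_nth_0)
  ultimately show ?case by blast
qed

text \<open>The residue field is prime, so the leading coefficient is the image of a natural number
  \<open>n\<close>; dividing by \<open>E j ^ n\<close> cancels it.\<close>

lemma U_decompose:
  fixes f :: "'p::prime_card mod_ring fps"
  assumes j: "1 \<le> j" and f: "f \<in> U j"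
  shows "\<exists>n g. f = E j ^ n * g \<and> g \<in> U (Suc j) \<and> of_nat n = f $ j"
proof -
  obtain n :: nat where n: "of_nat n = f $ j"
    using surj_of_nat_mod_ring[of "f $ j"] by metis
  obtain v where v: "f = 1 + fps_X ^ j * v"
    using f by (auto simp: U_iff_ex)
  obtain u where u: "E j ^ n = 1 + fps_X ^ j * u" "u $ 0 = (of_nat n :: 'p mod_ring)"
    using power_one_plus_X_power_mult[OF j, of "1 :: 'p mod_ring fps" n] by (auto simp: E_def)
  have E0: "(E j ^ n :: 'p mod_ring fps) $ 0 \<noteq> 0"
    by (simp add: fps_nth_power_0 E_nth_0[OF j])
  \<comment> \<open>The leading coefficients of \<open>f\<close> and \<open>E j ^ n\<close> agree,
    so their difference gains one factor \<open>fps_X\<close>.\<close>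
  have "(v - u) $ 0 = 0"
    using n u(2) j by (simp add: v fps_X_power_mult_nth)
  then have d: "v - u = fps_X * fps_shift 1 (v - u)"
    by (simp add: fps_eq_iff)
  define g where "g = f * inverse (E j ^ n)"
  have inv: "E j ^ n * inverse (E j ^ n) = (1 :: 'p mod_ring fps)"
    using E0 by (simp add: inverse_mult_eq_1')
  have "g - 1 = (f - E j ^ n) * inverse (E j ^ n)"
    using inv by (simp add: g_def algebra_simps)
  also have "f - E j ^ n = fps_X ^ j * (v - u)"
    by (simp add: v u algebra_simps)
  finally have "g \<in> U (Suc j)"
    unfolding U_def by (subst (asm) d) (simp add: mult.assoc)
  moreover have "E j ^ n * g = f"
    using inv by (simp add: g_def algebra_simps)
  ultimately show ?thesis using n by metis
qed

text \<open>Frobenius in characteristic \<open>p\<close>. This ties the value of a character at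
  \<open>E (p * i)\<close> to its value at \<open>E i\<close>.\<close>

lemma E_power_card:
  "(E j :: 'p::prime_card mod_ring fps) ^ CARD('p) = E (CARD('p) * j)"
proof -
  have "(1 + fps_X ^ j :: 'p mod_ring fps) ^ CHAR('p mod_ring fps)
          = 1 ^ CHAR('p mod_ring fps) + (fps_X ^ j) ^ CHAR('p mod_ring fps)"
    by (rule freshmans_dream) (simp_all add: prime_card)
  then show ?thesis
    by (simp add: E_def power_mult [symmetric] mult.commute)
qed

section \<open>Substitution of Nottingham series\<close>

lemma nottingham_nth_0: "w \<in> nottingham \<Longrightarrow> w $ 0 = 0"
  by (auto simp: nottingham_def)

lemma fps_X_in_nottingham: "fps_X \<in> nottingham"
  unfolding nottingham_def by (auto intro!: exI[of _ 1])

lemma U_compose: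
  assumes w: "w \<in> nottingham" and f: "f \<in> U j"
  shows "fps_compose f w \<in> U j"
proof -
  obtain z where z: "w = fps_X * z" using w by (auto simp: nottingham_def)
  obtain v where v: "f = 1 + fps_X ^ j * v" using f by (auto simp: U_iff_ex)
  have "fps_compose f w = 1 + fps_compose (fps_X ^ j) w * fps_compose v w"
    using nottingham_nth_0[OF w] by (simp add: v fps_compose_add_distrib fps_compose_mult_distrib)
  also have "fps_compose (fps_X ^ j) w = fps_X ^ j * z ^ j"
    using nottingham_nth_0[OF w]
    by (simp add: fps_compose_power[symmetric] z power_mult_distrib)
  finally show ?thesis by (auto simp: U_iff_ex mult.assoc)
qed

lemma nottingham_compose:
  assumes v: "v \<in> nottingham" and w: "w \<in> nottingham"
  shows "fps_compose v w \<in> nottingham"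
proof -
  obtain y where y: "v = fps_X * y" "y \<in> U 1" using v by (auto simp: nottingham_def)
  obtain z where z: "w = fps_X * z" "z \<in> U 1" using w by (auto simp: nottingham_def)
  have "fps_compose v w = fps_X * (z * fps_compose y w)"
    using nottingham_nth_0[OF w] by (simp add: y fps_compose_mult_distrib z(1) mult.assoc)
  then show ?thesis
    unfolding nottingham_def using U_mult[OF z(2) U_compose[OF w y(2)]] by blast
qed

lemma nottingham_act_act:
  assumes "v \<in> nottingham" "w \<in> nottingham"
  shows "nottingham_act v (nottingham_act w chi) = nottingham_act (fps_compose v w) chi"
  using assms by (simp add: nottingham_act_def fun_eq_iff fps_compose_assoc nottingham_nth_0)

text \<open>Substitution turns \<open>E j\<close> into \<open>1 + fps_X ^ j * z ^ j\<close>, and the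
  coefficient of \<open>z ^ j\<close> at \<open>k\<close> is \<open>j\<close> times that of
  \<open>z\<close>. Division by \<open>E j\<close>, whose constant term is 1, preserves this leading
  coefficient.\<close>

lemma E_compose:
  fixes z :: "'p::prime_card mod_ring fps"
  assumes j: "1 \<le> j" and k: "1 \<le> k" and z: "z \<in> U k"
  shows "\<exists>h\<in>U (j + k). fps_compose (E j) (fps_X * z) = E j * h \<and>
           h $ (j + k) = of_nat j * z $ k"
proof -
  obtain v where v: "z = 1 + fps_X ^ k * v" using z by (auto simp: U_iff_ex)
  obtain u where u: "z ^ j = 1 + fps_X ^ k * u" "u $ 0 = of_nat j * v $ 0"
    using power_one_plus_X_power_mult[OF k, of v j] by (auto simp: v)
  have zk: "z $ k = v $ 0" using k by (simp add: v fps_X_power_mult_nth)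
  have inv: "E j * inverse (E j) = (1 :: 'p mod_ring fps)"
    by (rule inverse_mult_eq_1') (simp add: E_nth_0[OF j])
  define h where "h = 1 + fps_X ^ (j + k) * (u * inverse (E j))"
  have "h \<in> U (j + k)" by (auto simp: h_def U_iff_ex)
  moreover have "h $ (j + k) = of_nat j * z $ k"
    using j by (simp add: h_def fps_X_power_mult_nth u zk E_nth_0[OF j])
  moreover have "fps_compose (E j) (fps_X * z) = E j * h"
  proof -
    have "fps_compose (E j) (fps_X * z) = 1 + fps_X ^ j * z ^ j"
      by (simp add: E_def fps_compose_add_distrib fps_compose_power[symmetric] power_mult_distrib)
    also have "\<dots> = E j + fps_X ^ (j + k) * u * (E j * inverse (E j))"
      unfolding inv by (simp add: E_def u algebra_simps power_add)
    also have "\<dots> = E j * h"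
      by (simp add: h_def algebra_simps)
    finally show ?thesis .
  qed
  ultimately show ?thesis by blast
qed

section \<open>Characters with two breaks\<close>

lemma of_int_mod_ring_eq_iff:
  "(of_int a :: 'p::prime_card mod_ring) = of_int b \<longleftrightarrow> [a = b] (mod int CARD('p))"
  by (simp add: of_int_eq_iff_cong_CHAR)

lemma of_int_mod_card [simp]:
  "of_int (a mod int CARD('p)) = (of_int a :: 'p::prime_card mod_ring)"
  using of_int_mod_CHAR[of a, where 'a = "'p mod_ring"] by simp

text \<open>Division by \<open>p\<close> is additive on multiples of \<open>p\<close>, and a change
  by a multiple of \<open>p^2\<close> alters the quotient only by a multiple of
  \<open>p\<close>.\<close>

lemma of_int_div_card:
  fixes u v w :: int
  assumes cong: "[u = v + n * w] (mod (int CARD('p::prime_card))\<^sup>2)"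
    and dvd: "int CARD('p) dvd v" "int CARD('p) dvd w"
  shows "(of_int (u div int CARD('p)) :: 'p mod_ring) =
           of_int (v div int CARD('p)) + of_int n * of_int (w div int CARD('p))"
proof -
  define p where "p = int CARD('p)"
  have p0: "p \<noteq> 0" by (simp add: p_def)
  from dvd obtain v' w' where vw: "v = p * v'" "w = p * w'"
    by (auto simp: p_def elim!: dvdE)
  from cong obtain t where "u = v + n * w + t * p\<^sup>2"
    unfolding cong_sym_eq[of u] by (auto simp: p_def cong_iff_lin mult.commute)
  then have "u = p * (v' + n * w' + t * p)"
    by (simp add: vw power2_eq_square algebra_simps)
  then have "u div p = v' + n * w' + t * p" using p0 by simp
  then have "[u div p = v' + n * w'] (mod p)"
    by (simp add: cong_def)
  then have "(of_int (u div p) :: 'p mod_ring) = of_int (v' + n * w')"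
    unfolding of_int_mod_ring_eq_iff p_def .
  then show ?thesis using p0 by (simp add: vw p_def)
qed

section \<open>Homomorphisms from \<open>U 1\<close> to the residues modulo
  \<open>p^2\<close>\<close>

locale unit_character =
  fixes chi :: "'p::prime_card mod_ring fps \<Rightarrow> int"
  assumes range: "f \<in> U 1 \<Longrightarrow> 0 \<le> chi f \<and> chi f < (int CARD('p))\<^sup>2"
    and mult: "f \<in> U 1 \<Longrightarrow> g \<in> U 1 \<Longrightarrow> [chi (f * g) = chi f + chi g] (mod (int CARD('p))\<^sup>2)"
begin

lemma one: "chi 1 = 0"
proof -
  have "[chi 1 + 0 = chi 1 + chi 1] (mod (int CARD('p))\<^sup>2)"
    using mult[of 1 1] by simp
  then have "[0 = chi 1] (mod (int CARD('p))\<^sup>2)"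
    by (simp only: cong_add_lcancel)
  then show ?thesis
    using range[of 1] by (simp add: cong_def)
qed

lemma eqI:
  fixes psi :: "'p mod_ring fps \<Rightarrow> int"
  assumes "unit_character psi" "f \<in> U 1" "g \<in> U 1"
    and "[chi f = psi g] (mod (int CARD('p))\<^sup>2)"
  shows "chi f = psi g"
  using range[OF assms(2)] unit_character.range[OF assms(1,3)] assms(4)
  by (simp add: cong_def)

lemma power: "f \<in> U 1 \<Longrightarrow> [chi (f ^ n) = int n * chi f] (mod (int CARD('p))\<^sup>2)"
proof (induction n)
  case 0
  show ?case using one by simp
next
  case (Suc n)
  have "[chi (f * f ^ n) = chi f + chi (f ^ n)] (mod (int CARD('p))\<^sup>2)"
    using Suc.prems by (intro mult U_power)
  also have "[chi f + chi (f ^ n) = chi f + int n * chi f] (mod (int CARD('p))\<^sup>2)"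
    using Suc by (intro cong_add) auto
  finally show ?case by (simp add: algebra_simps)
qed

lemma decompose:
  assumes j: "1 \<le> j" and f: "f \<in> U j"
  shows "\<exists>n g. of_nat n = f $ j \<and> g \<in> U (Suc j) \<and>
           [chi f = int n * chi (E j) + chi g] (mod (int CARD('p))\<^sup>2)"
proof -
  obtain n g where *: "f = E j ^ n * g" "g \<in> U (Suc j)" "of_nat n = f $ j"
    using U_decompose[OF j f] by blast
  have "[chi f = chi (E j ^ n) + chi g] (mod (int CARD('p))\<^sup>2)"
    unfolding *(1) using j *(2) by (intro mult U_power E_in_U') (auto intro: U_antimono)
  also have "[chi (E j ^ n) + chi g = int n * chi (E j) + chi g] (mod (int CARD('p))\<^sup>2)"
    using j by (intro cong_add power E_in_U') auto
  finally show ?thesis using * by blast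
qed

text \<open>A value prime to \<open>p\<close> generates the residues modulo \<open>p^2\<close>.
  Since each \<open>U j\<close> is closed under powers, one such value on \<open>U j\<close> makes
  the exact value 1 occur there.\<close>

lemma power_eq_if_coprime:
  assumes f: "f \<in> U 1" and p: "\<not> int CARD('p) dvd chi f" and v: "0 \<le> v" "v < (int CARD('p))\<^sup>2"
  shows "\<exists>n. chi (f ^ n) = v"
proof -
  have "coprime (chi f) ((int CARD('p))\<^sup>2)"
    using p prime_imp_coprime[OF prime_card_int[where 'a = 'p]] by (simp add: coprime_commute)
  then obtain x where x: "[chi f * x = 1] (mod (int CARD('p))\<^sup>2)"
    using cong_solve_coprime_int by blast
  define n where "n = nat ((x * v) mod (int CARD('p))\<^sup>2)"
  have "[int n * chi f = x * v * chi f] (mod (int CARD('p))\<^sup>2)"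
    by (intro cong_mult) (auto simp: n_def)
  also have "x * v * chi f = chi f * x * v" by simp
  also have "[chi f * x * v = 1 * v] (mod (int CARD('p))\<^sup>2)"
    by (intro cong_mult x) auto
  finally have "[chi (f ^ n) = v] (mod (int CARD('p))\<^sup>2)"
    using power[OF f, of n] cong_trans by fastforce
  then have "chi (f ^ n) = v"
    using range[OF U_power[OF f], of n] v by (simp add: cong_def)
  then show ?thesis ..
qed

text \<open>A nonzero residue modulo \<open>p^2\<close> is a unit or \<open>p\<close> times a unit,
  so some multiple of it is \<open>p\<close>.\<close>

lemma power_eq_card:
  assumes f: "f \<in> U 1" and nz: "chi f \<noteq> 0"
  shows "\<exists>n. chi (f ^ n) = int CARD('p)"
proof (cases "int CARD('p) dvd chi f")
  case False
  have "int CARD('p) < (int CARD('p))\<^sup>2"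
    using prime_gt_1_int[OF prime_card_int[where 'a = 'p]] by (simp add: power2_eq_square)
  then show ?thesis using power_eq_if_coprime[OF f False] by simp
next
  case True
  then obtain v where v: "chi f = int CARD('p) * v" by (elim dvdE)
  have "\<not> int CARD('p) dvd v"
  proof
    assume "int CARD('p) dvd v"
    then have "(int CARD('p))\<^sup>2 dvd chi f" by (simp add: v power2_eq_square)
    then show False using range[OF f] nz zdvd_imp_le by force
  qed
  then have "coprime v (int CARD('p))"
    using prime_imp_coprime[OF prime_card_int[where 'a = 'p]] by (simp add: coprime_commute)
  then obtain x where x: "[v * x = 1] (mod int CARD('p))"
    using cong_solve_coprime_int by blast
  define n where "n = nat (x mod int CARD('p))"
  have "[v * int n = v * x] (mod int CARD('p))"
    by (intro cong_mult) (auto simp: n_def)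
  from cong_cmult_leftI[OF cong_trans[OF this x], of "int CARD('p)"]
  have "[int n * chi f = int CARD('p)] (mod (int CARD('p))\<^sup>2)"
    by (simp add: v power2_eq_square mult_ac)
  with power[OF f, of n] have "[chi (f ^ n) = int CARD('p)] (mod (int CARD('p))\<^sup>2)"
    by (rule cong_trans)
  moreover have "int CARD('p) < (int CARD('p))\<^sup>2"
    using prime_gt_1_int[OF prime_card_int[where 'a = 'p]] by (simp add: power2_eq_square)
  ultimately have "chi (f ^ n) = int CARD('p)"
    using range[OF U_power[OF f], of n] by (simp add: cong_def)
  then show ?thesis ..
qed

end

text \<open>Type \<open>[2, m]\<close> recast without maxima: the break 2 of the character modulo
  \<open>p\<close> and the break \<open>m\<close> of the full character, each witnessed at a single
  \<open>E j\<close>. In this form invariance under substitution can be checked directly.\<close>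

locale break_character = unit_character chi
  for m :: nat and chi :: "'p::prime_card mod_ring fps \<Rightarrow> int" +
  assumes dvd_U3: "f \<in> U 3 \<Longrightarrow> int CARD('p) dvd chi f"
    and zero_U: "f \<in> U (Suc m) \<Longrightarrow> chi f = 0"
    and E2: "\<not> int CARD('p) dvd chi (E 2)"
    and Em: "chi (E m) \<noteq> 0"
begin

section \<open>Constraints on \<open>p\<close> and \<open>m\<close>\<close>

lemma E_card_mult:
  assumes "1 \<le> j"
  shows "[chi (E (CARD('p) * j)) = int CARD('p) * chi (E j)] (mod (int CARD('p))\<^sup>2)"
  using power[OF E_in_U'[OF assms], of "CARD('p)"] by (simp add: E_power_card)

text \<open>For \<open>p = 2\<close> the unit \<open>E 2\<close> would be the square of
  \<open>E 1\<close>, making its value even.\<close>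

lemma card_ge_3: "3 \<le> CARD('p)"
proof (rule ccontr)
  assume "\<not> 3 \<le> CARD('p)"
  with prime_ge_2_nat[OF prime_card[where 'a = 'p]] have 2: "CARD('p) = 2" by simp
  have "[chi (E (CARD('p) * 1)) = int CARD('p) * chi (E 1)] (mod int CARD('p))"
    by (rule cong_dvd_modulus[OF E_card_mult]) (auto simp: power2_eq_square)
  then have "int CARD('p) dvd chi (E 2)"
    by (simp add: 2 cong_def mod_eq_0_iff_dvd)
  with E2 show False ..
qed

text \<open>The \<open>p\<close>-th power of \<open>E 2\<close> is \<open>E (p * 2)\<close>, whose
  value is \<open>p\<close> times a number prime to \<open>p\<close>, so the character does not yet
  vanish on \<open>U (p * 2)\<close>.\<close>

lemma m_ge: "2 * CARD('p) \<le> m"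
proof (rule ccontr)
  assume "\<not> 2 * CARD('p) \<le> m"
  then have "chi (E (CARD('p) * 2)) = 0"
    by (intro zero_U E_in_U') simp
  then have "[int CARD('p) * chi (E 2) = 0] (mod (int CARD('p))\<^sup>2)"
    using E_card_mult[of 2] by (simp add: cong_sym_eq)
  then have "int CARD('p) * int CARD('p) dvd int CARD('p) * chi (E 2)"
    by (simp add: cong_0_iff power2_eq_square)
  then have "int CARD('p) dvd chi (E 2)" by simp
  with E2 show False ..
qed

lemma m_ge_6: "6 \<le> m"
  using m_ge card_ge_3 by simp

lemma Em_dvd: "int CARD('p) dvd chi (E m)"
  using m_ge_6 by (intro dvd_U3 E_in_U') simp

text \<open>If \<open>m = p * i\<close> with \<open>i >= 3\<close>, then \<open>p\<close> divides
  the value at \<open>E i\<close>, so the value at its \<open>p\<close>-th power \<open>E m\<close>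
  would be 0 modulo \<open>p^2\<close>.\<close>

lemma m_eq:
  assumes "CARD('p) dvd m"
  shows "m = CARD('p) * 2"
proof -
  obtain i where i: "m = CARD('p) * i" using assms by (elim dvdE)
  have i1: "i \<ge> 2" using m_ge i by (simp add: mult.commute)
  have "i < 3"
  proof (rule ccontr)
    assume "\<not> i < 3"
    then have "int CARD('p) dvd chi (E i)"
      by (intro dvd_U3 E_in_U') simp
    then have "(int CARD('p))\<^sup>2 dvd int CARD('p) * chi (E i)"
      by (simp add: power2_eq_square)
    moreover have "[chi (E m) = int CARD('p) * chi (E i)] (mod (int CARD('p))\<^sup>2)"
      unfolding i using i1 by (intro E_card_mult) simp
    ultimately have "(int CARD('p))\<^sup>2 dvd chi (E m)"
      using cong_dvd_iff by blast
    moreover have "0 \<le> chi (E m) \<and> chi (E m) < (int CARD('p))\<^sup>2"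
      using m_ge_6 by (intro range E_in_U') simp
    ultimately show False
      using Em zdvd_imp_le by force
  qed
  with i1 have "i = 2" by simp
  with i show ?thesis by simp
qed

lemma coeff_x_2_nonzero: "coeff_x chi 2 \<noteq> 0"
proof -
  have "coeff_x chi 2 = of_int (chi (E 2))"
    by (simp add: coeff_x_def)
  then show ?thesis
    using of_int_mod_ring_eq_iff[of "chi (E 2)" 0, where 'p = 'p] E2
    by (simp add: cong_0_iff)
qed

lemma coeff_a_m_nonzero: "coeff_a chi m \<noteq> 0"
proof
  assume "coeff_a chi m = 0"
  then have "int CARD('p) dvd chi (E m) div int CARD('p)"
    using of_int_mod_ring_eq_iff[of "chi (E m) div int CARD('p)" 0, where 'p = 'p]
    by (simp add: coeff_a_def cong_0_iff)
  then have "int CARD('p) * int CARD('p) dvd chi (E m)"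
    using Em_dvd by (metis dvd_mult_div_cancel mult_dvd_mono dvd_refl)
  moreover have "0 \<le> chi (E m) \<and> chi (E m) < (int CARD('p))\<^sup>2"
    using m_ge_6 by (intro range E_in_U') simp
  ultimately show False
    using Em zdvd_imp_le by (force simp: power2_eq_square)
qed

text \<open>Taking a \<open>p\<close>-th power multiplies the value by \<open>p\<close>, which moves
  the lower digit into the upper place.\<close>

lemma coeff_a_m_eq_coeff_x:
  assumes "CARD('p) dvd m"
  shows "coeff_a chi m = coeff_x chi 2"
proof -
  have "[chi (E m) = 0 + chi (E 2) * int CARD('p)] (mod (int CARD('p))\<^sup>2)"
    using E_card_mult[of 2] by (simp add: m_eq[OF assms] mult.commute)
  from of_int_div_card[OF this] show ?thesis
    by (simp add: coeff_a_def coeff_x_def)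
qed

section \<open>Values at \<open>E j\<close> after a substitution\<close>

text \<open>The factor by which substitution changes \<open>E j\<close> is split into its leading
  part and a remainder one step deeper. The next three lemmas evaluate this for \<open>j + k\<close>
  at least 3, equal to \<open>m\<close>, and beyond \<open>m\<close>.\<close>

lemma E_compose_cong:
  assumes j: "1 \<le> j" and k: "1 \<le> k" and z: "z \<in> U k"
  shows "\<exists>n g. of_nat n = of_nat j * z $ k \<and> g \<in> U (Suc (j + k)) \<and>
           [chi (fps_compose (E j) (fps_X * z)) = chi (E j) + int n * chi (E (j + k)) + chi g]
             (mod (int CARD('p))\<^sup>2)"
proof -
  obtain h where h: "h \<in> U (j + k)" "fps_compose (E j) (fps_X * z) = E j * h"
      "h $ (j + k) = of_nat j * z $ k"
    using E_compose[OF j k z] by blast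
  obtain n g where g: "of_nat n = h $ (j + k)" "g \<in> U (Suc (j + k))"
      "[chi h = int n * chi (E (j + k)) + chi g] (mod (int CARD('p))\<^sup>2)"
    using decompose[OF _ h(1)] j by auto
  have "[chi (E j * h) = chi (E j) + chi h] (mod (int CARD('p))\<^sup>2)"
    using j by (intro mult E_in_U' U_antimono[OF _ h(1)]) auto
  also have "[chi (E j) + chi h = chi (E j) + (int n * chi (E (j + k)) + chi g)]
               (mod (int CARD('p))\<^sup>2)"
    by (intro cong_add g(3)) auto
  finally show ?thesis
    using g h by (metis add.assoc)
qed

text \<open>The change lies in \<open>U 3\<close>, where values are divisible by \<open>p\<close>;
  thus only \<open>j = k = 1\<close> can move a value modulo \<open>p\<close>.\<close>

lemma E_compose_cong_p:
  assumes j: "1 \<le> j" and k: "1 \<le> k" and z: "z \<in> U k" and "3 \<le> j + k"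
  shows "[chi (fps_compose (E j) (fps_X * z)) = chi (E j)] (mod int CARD('p))"
proof -
  obtain n g where g: "g \<in> U (Suc (j + k))"
      "[chi (fps_compose (E j) (fps_X * z)) = chi (E j) + int n * chi (E (j + k)) + chi g]
             (mod (int CARD('p))\<^sup>2)"
    using E_compose_cong[OF j k z] by blast
  have "[chi (fps_compose (E j) (fps_X * z)) = chi (E j) + int n * chi (E (j + k)) + chi g]
             (mod int CARD('p))"
    by (rule cong_dvd_modulus[OF g(2)]) simp
  also have "[chi (E j) + int n * chi (E (j + k)) + chi g = chi (E j) + int n * 0 + 0] (mod int CARD('p))"
    using assms(4)
    by (intro cong_add cong_mult)
      (auto simp: cong_0_iff intro!: dvd_U3 E_in_U' U_antimono[OF _ g(1)])
  finally show ?thesis by simp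
qed

lemma E_compose_top:
  assumes j: "1 \<le> j" and k: "1 \<le> k" and z: "z \<in> U k" and m: "j + k = m"
  shows "\<exists>n. of_nat n = of_nat j * z $ k \<and>
           [chi (fps_compose (E j) (fps_X * z)) = chi (E j) + int n * chi (E m)]
             (mod (int CARD('p))\<^sup>2)"
  using E_compose_cong[OF j k z] zero_U m by fastforce

lemma E_compose_fix:
  assumes j: "1 \<le> j" and k: "1 \<le> k" and z: "z \<in> U k" and m: "m < j + k"
  shows "chi (fps_compose (E j) (fps_X * z)) = chi (E j)"
proof -
  have "z \<in> U 1" using U_antimono[OF k z] .
  then have w: "fps_X * z \<in> nottingham" by (auto simp: nottingham_def)
  obtain n g where g: "g \<in> U (Suc (j + k))"
      "[chi (fps_compose (E j) (fps_X * z)) = chi (E j) + int n * chi (E (j + k)) + chi g]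
             (mod (int CARD('p))\<^sup>2)"
    using E_compose_cong[OF j k z] by blast
  have "chi (E (j + k)) = 0" "chi g = 0"
    using m by (auto intro!: zero_U E_in_U' U_antimono[OF _ g(1)])
  with g(2) show ?thesis
    using j by (intro eqI[OF unit_character_axioms] U_compose[OF w] E_in_U') auto
qed

text \<open>Substitution preserves every \<open>U j\<close>, hence both vanishing conditions. It
  multiplies \<open>E 2\<close> by an element of \<open>U 3\<close> and \<open>E m\<close> by one of
  \<open>U (Suc m)\<close>, so the conditions at these two units survive as well.\<close>

lemma break_character_act:
  assumes w: "w \<in> nottingham"
  shows "break_character m (nottingham_act w chi)"
proof -
  obtain z where z: "w = fps_X * z" "z \<in> U 1" using w by (auto simp: nottingham_def)
  show ?thesis
  proof
    fix f :: "'p mod_ring fps" assume f: "f \<in> U 1"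
    show "0 \<le> nottingham_act w chi f \<and> nottingham_act w chi f < (int CARD('p))\<^sup>2"
      unfolding nottingham_act_def by (intro range U_compose w f)
  next
    fix f g :: "'p mod_ring fps" assume "f \<in> U 1" "g \<in> U 1"
    then show "[nottingham_act w chi (f * g) = nottingham_act w chi f + nottingham_act w chi g]
                 (mod (int CARD('p))\<^sup>2)"
      unfolding nottingham_act_def fps_compose_mult_distrib[OF nottingham_nth_0[OF w]]
      by (intro mult U_compose w)
  next
    fix f :: "'p mod_ring fps" assume "f \<in> U 3"
    then show "int CARD('p) dvd nottingham_act w chi f"
      unfolding nottingham_act_def by (intro dvd_U3 U_compose w)
  next
    fix f :: "'p mod_ring fps" assume "f \<in> U (Suc m)"
    then show "nottingham_act w chi f = 0"
      unfolding nottingham_act_def by (intro zero_U U_compose w)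
  next
    have "[chi (fps_compose (E 2) w) = chi (E 2)] (mod int CARD('p))"
      unfolding z(1) by (rule E_compose_cong_p[OF _ _ z(2)]) auto
    then show "\<not> int CARD('p) dvd nottingham_act w chi (E 2)"
      using E2 cong_dvd_iff by (auto simp: nottingham_act_def)
  next
    have "chi (fps_compose (E m) w) = chi (E m)"
      unfolding z(1) using m_ge_6 by (intro E_compose_fix[OF _ _ z(2)]) auto
    then show "nottingham_act w chi (E m) \<noteq> 0"
      using Em by (simp add: nottingham_act_def)
  qed
qed

section \<open>Comparing two characters through the units \<open>E j\<close>\<close>

text \<open>Descent along the filtration: both characters vanish on \<open>U (Suc m)\<close>, and
  passing from \<open>U (Suc j)\<close> to \<open>U j\<close> adds only powers of
  \<open>E j\<close>.\<close>

lemma eq_on_U1: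
  assumes psi: "break_character m psi"
    and E: "\<And>j. 1 \<le> j \<Longrightarrow> psi (E j) = chi (E j)"
    and f: "f \<in> U 1"
  shows "psi f = chi f"
proof -
  have *: "psi f = chi f" if "j \<le> Suc m" "1 \<le> j" "f \<in> U j" for f j
    using that
  proof (induction arbitrary: f rule: inc_induct)
    case base
    then show ?case using zero_U break_character.zero_U[OF psi] by simp
  next
    case (step j)
    obtain n g where g: "f = E j ^ n * g" "g \<in> U (Suc j)"
      using U_decompose step.prems by blast
    have U1: "f \<in> U 1" "g \<in> U 1" "E j \<in> (U 1 :: 'p mod_ring fps set)"
      using step.prems(1) U_antimono[OF step.prems] U_antimono[OF _ g(2), of 1]
      by (auto intro: E_in_U')
    have *: "[phi f = int n * phi (E j) + phi g] (mod (int CARD('p))\<^sup>2)"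
      if "break_character m phi" for phi :: "'p mod_ring fps \<Rightarrow> int"
    proof -
      interpret phi: break_character m phi by fact
      show ?thesis
        unfolding g(1)
        by (rule cong_trans[OF phi.mult[OF U_power[OF U1(3)] U1(2)]
              cong_add[OF phi.power[OF U1(3)] cong_refl]])
    qed
    have "int n * psi (E j) + psi g = int n * chi (E j) + chi g"
      using step.IH[OF _ g(2)] E[OF step.prems(1)] by simp
    then have "[chi f = psi f] (mod (int CARD('p))\<^sup>2)"
      using *[OF psi] *[OF break_character_axioms] by (metis cong_sym cong_trans)
    from eqI[OF break_character.axioms(1)[OF psi] U1(1) U1(1) this] show ?case ..
  qed
  show ?thesis by (rule *[OF _ _ f]) simp_all
qed

lemma coeff_x_eq_iff:
  fixes psi :: "'p mod_ring fps \<Rightarrow> int"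
  shows "coeff_x psi j = coeff_x chi j \<longleftrightarrow> [psi (E j) = chi (E j)] (mod int CARD('p))"
  unfolding coeff_x_def of_int_mod_card of_int_mod_ring_eq_iff ..

text \<open>From index 3 on the lower digit is 0, so the upper digit determines the value.\<close>

lemma coeff_a_eqD:
  fixes psi :: "'p mod_ring fps \<Rightarrow> int"
  assumes psi: "break_character m' psi" and j: "3 \<le> j"
    and eq: "coeff_a psi j = coeff_a chi j"
  shows "psi (E j) = chi (E j)"
proof -
  interpret psi: break_character m' psi by fact
  have E: "E j \<in> (U 1 :: 'p mod_ring fps set)" using j by (intro E_in_U') simp
  have dvd: "int CARD('p) dvd psi (E j)" "int CARD('p) dvd chi (E j)"
    using j by (auto intro!: dvd_U3 psi.dvd_U3 E_in_U')
  have "[psi (E j) div int CARD('p) = chi (E j) div int CARD('p)] (mod int CARD('p))"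
    using eq unfolding coeff_a_def of_int_mod_ring_eq_iff .
  then have "[int CARD('p) * (psi (E j) div int CARD('p)) =
               int CARD('p) * (chi (E j) div int CARD('p))] (mod int CARD('p) * int CARD('p))"
    by (rule cong_cmult_leftI)
  then have "[psi (E j) = chi (E j)] (mod (int CARD('p))\<^sup>2)"
    using dvd by (simp add: power2_eq_square)
  then show ?thesis using psi.eqI[OF unit_character_axioms E E] by simp
qed

text \<open>Here \<open>E j\<close> is a \<open>p\<close>-th power, so its value is \<open>p\<close>
  times another value and depends only on the latter modulo \<open>p\<close>.\<close>

lemma E_eq_if_card_dvd:
  fixes psi :: "'p mod_ring fps \<Rightarrow> int"
  assumes psi: "break_character m' psi" and j: "1 \<le> j" "CARD('p) dvd j"
    and eq: "\<And>i. 1 \<le> i \<Longrightarrow> [psi (E i) = chi (E i)] (mod int CARD('p))"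
  shows "psi (E j) = chi (E j)"
proof -
  interpret psi: break_character m' psi by fact
  obtain i where i: "j = CARD('p) * i" using j(2) by (elim dvdE)
  then have i1: "1 \<le> i" using j(1) by (cases i) auto
  have *: "[int CARD('p) * psi (E i) = int CARD('p) * chi (E i)] (mod (int CARD('p))\<^sup>2)"
    unfolding power2_eq_square by (rule cong_cmult_leftI[OF eq[OF i1]])
  have "[psi (E j) = chi (E j)] (mod (int CARD('p))\<^sup>2)"
    unfolding i
    by (rule cong_trans[OF psi.E_card_mult[OF i1] cong_trans[OF * cong_sym[OF E_card_mult[OF i1]]]])
  then show ?thesis
    using j(1) by (intro psi.eqI[OF unit_character_axioms] E_in_U') auto
qed

section \<open>Adjusting coefficients by substitution\<close>

text \<open>This is the case \<open>k = 1\<close>. The change of \<open>E 1\<close> lies in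
  \<open>U 2\<close> and is seen modulo \<open>p\<close> only through \<open>E 2\<close>; that of
  \<open>E (m - 1)\<close> lies in \<open>U m\<close> and is seen only through
  \<open>E m\<close>.\<close>

lemma coeff_act:
  assumes z: "z \<in> U 1"
  shows "coeff_x (nottingham_act (fps_X * z) chi) 1 = coeff_x chi 1 + z $ 1 * coeff_x chi 2"
    and "coeff_x (nottingham_act (fps_X * z) chi) 2 = coeff_x chi 2"
    and "coeff_a (nottingham_act (fps_X * z) chi) m = coeff_a chi m"
    and "coeff_a (nottingham_act (fps_X * z) chi) (m - 1) =
           coeff_a chi (m - 1) + of_nat (m - 1) * z $ 1 * coeff_a chi m"
proof -
  let ?psi = "nottingham_act (fps_X * z) chi"
  obtain n g where n: "of_nat n = z $ 1" "g \<in> U 3"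
      "[?psi (E 1) = chi (E 1) + int n * chi (E 2) + chi g] (mod (int CARD('p))\<^sup>2)"
    using E_compose_cong[OF _ _ z, of 1] by (auto simp: nottingham_act_def numeral_eq_Suc)
  have "[?psi (E 1) = chi (E 1) + int n * chi (E 2) + chi g] (mod int CARD('p))"
    by (rule cong_dvd_modulus[OF n(3)]) simp
  also have "[chi (E 1) + int n * chi (E 2) + chi g = chi (E 1) + int n * chi (E 2) + 0]
      (mod int CARD('p))"
    by (intro cong_add) (auto simp: cong_0_iff intro: dvd_U3 n(2))
  finally have "(of_int (?psi (E 1)) :: 'p mod_ring) = of_int (chi (E 1) + int n * chi (E 2))"
    by (simp only: of_int_mod_ring_eq_iff add_0_right)
  then show "coeff_x ?psi 1 = coeff_x chi 1 + z $ 1 * coeff_x chi 2"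
    by (simp add: coeff_x_def n(1) del: One_nat_def)
  show "coeff_x ?psi 2 = coeff_x chi 2"
    unfolding coeff_x_eq_iff nottingham_act_def by (rule E_compose_cong_p[OF _ _ z]) auto
  show "coeff_a ?psi m = coeff_a chi m"
    using m_ge_6 E_compose_fix[OF _ _ z, of m] by (simp add: nottingham_act_def coeff_a_def)
  obtain k where k: "of_nat k = of_nat (m - 1) * z $ 1"
      "[?psi (E (m - 1)) = chi (E (m - 1)) + int k * chi (E m)] (mod (int CARD('p))\<^sup>2)"
    using E_compose_top[OF _ _ z, of "m - 1"] m_ge_6 unfolding nottingham_act_def by force
  have "int CARD('p) dvd chi (E (m - 1))" using m_ge_6 by (intro dvd_U3 E_in_U') simp
  from of_int_div_card[OF k(2) this Em_dvd]
  show "coeff_a ?psi (m - 1) = coeff_a chi (m - 1) + of_nat (m - 1) * z $ 1 * coeff_a chi m"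
    by (simp add: coeff_a_def k(1) del: of_nat_diff)
qed

text \<open>Induction on the largest index \<open>s\<close> that may still disagree, with
  \<open>chi\<close> replaced at each correction by its transform. The bound
  \<open>s + 2 <= m\<close> keeps \<open>k = m - s\<close> at least 2, so values modulo
  \<open>p\<close> stay fixed.\<close>

lemma conjugate_if_agree_above:
  assumes "break_character m psi" and "s + 2 \<le> m"
    and "\<And>j. s < j \<Longrightarrow> psi (E j) = chi (E j)"
    and "\<And>j. 1 \<le> j \<Longrightarrow> [psi (E j) = chi (E j)] (mod int CARD('p))"
  shows "\<exists>w\<in>nottingham. \<forall>f\<in>U 1. psi f = nottingham_act w chi f"
  using break_character_axioms assms
proof (induction s arbitrary: chi)
  case (0 chi)
  then show ?case
    using break_character.eq_on_U1[OF 0(1,2)] fps_X_in_nottingham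
    by (intro bexI[of _ fps_X]) (auto simp: nottingham_act_def)
next
  case (Suc s chi)
  interpret chi: break_character m chi by fact
  interpret psi: break_character m psi by fact
  show ?case
  proof (cases "CARD('p) dvd Suc s")
    case True
    have "psi (E j) = chi (E j)" if "s < j" for j
      using that Suc.prems(4)[of j] chi.E_eq_if_card_dvd[OF Suc.prems(2) _ True Suc.prems(5)]
      by (cases "j = Suc s") auto
    with Suc.prems show ?thesis by (intro Suc.IH) auto
  next
    case False
    define k where "k = m - Suc s"
    have k: "2 \<le> k" "Suc s + k = m" using Suc.prems(3) by (auto simp: k_def)
    \<comment> \<open>The values agree modulo \<open>p\<close>; \<open>r\<close> is their
      discrepancy in units of \<open>p\<close>.\<close>
    obtain r where r: "psi (E (Suc s)) = chi (E (Suc s)) + int CARD('p) * r"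
      using Suc.prems(5)[of "Suc s"] unfolding cong_sym_eq[of "psi _"]
      by (auto simp: cong_iff_lin)
    obtain A where A: "chi (E m) = int CARD('p) * A" using chi.Em_dvd by (elim dvdE)
    have A0: "(of_int A :: 'p mod_ring) \<noteq> 0"
      using chi.coeff_a_m_nonzero by (simp add: coeff_a_def A)
    have s0: "(of_nat (Suc s) :: 'p mod_ring) \<noteq> 0"
      using False of_nat_0_mod_ring_dvd by blast
    \<comment> \<open>The solution of \<open>Suc s * c * A = r\<close> in the prime field, where
      \<open>A\<close> is the upper digit of the value at \<open>E m\<close>.\<close>
    define c :: "'p mod_ring" where "c = of_int r / (of_nat (Suc s) * of_int A)"
    define z where "z = 1 + fps_X ^ k * fps_const c"
    have z: "z \<in> U k" by (auto simp: z_def U_iff_ex)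
    have zk: "z $ k = c" using k by (simp add: z_def fps_X_power_mult_nth)
    define w where "w = fps_X * z"
    have w: "w \<in> nottingham"
      using U_antimono[OF _ z, of 1] k by (auto simp: w_def nottingham_def)
    define chi' where "chi' = nottingham_act w chi"
    interpret chi': break_character m chi'
      unfolding chi'_def by (rule chi.break_character_act[OF w])
    have "\<exists>v\<in>nottingham. \<forall>f\<in>U 1. psi f = nottingham_act v chi' f"
    proof (rule Suc.IH)
      show "break_character m chi'" by (rule chi'.break_character_axioms)
      show "break_character m psi" by fact
      show "s + 2 \<le> m" using Suc.prems(3) by simp
      show "[psi (E j) = chi' (E j)] (mod int CARD('p))" if "1 \<le> j" for j
      proof -
        have "[chi' (E j) = chi (E j)] (mod int CARD('p))"
          unfolding chi'_def nottingham_act_def w_def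
          using that k by (intro chi.E_compose_cong_p[OF _ _ z]) auto
        with Suc.prems(5)[OF that] show ?thesis by (metis cong_sym cong_trans)
      qed
      show "psi (E j) = chi' (E j)" if "s < j" for j
      proof (cases "j = Suc s")
        case False
        with that have "Suc s < j" by simp
        \<comment> \<open>Now \<open>j + k\<close> exceeds \<open>m\<close>, so values already
          matched are untouched.\<close>
        then have "chi' (E j) = chi (E j)"
          unfolding chi'_def nottingham_act_def w_def
          using k by (intro chi.E_compose_fix[OF _ _ z]) auto
        with Suc.prems(4)[OF \<open>Suc s < j\<close>] show ?thesis by simp
      next
        case True
        obtain n where n: "of_nat n = of_nat (Suc s) * c"
            "[chi' (E j) = chi (E j) + int n * chi (E m)] (mod (int CARD('p))\<^sup>2)"
          using chi.E_compose_top[OF _ _ z k(2)] k(1)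
          by (auto simp: chi'_def nottingham_act_def w_def zk True)
        have "of_int (int n * A) = (of_int r :: 'p mod_ring)"
          using A0 s0 by (simp add: n(1) c_def del: of_nat_Suc)
        then have "[int n * A = r] (mod int CARD('p))"
          by (simp only: of_int_mod_ring_eq_iff)
        then have "[int CARD('p) * (int n * A) = int CARD('p) * r] (mod (int CARD('p))\<^sup>2)"
          unfolding power2_eq_square by (rule cong_cmult_leftI)
        then have "[chi (E j) + int n * chi (E m) = psi (E j)] (mod (int CARD('p))\<^sup>2)"
          unfolding A True r by (intro cong_add) (auto simp: algebra_simps)
        with n(2) have "[psi (E j) = chi' (E j)] (mod (int CARD('p))\<^sup>2)"
          by (metis cong_sym cong_trans)
        then show ?thesis
          using that by (intro psi.eqI[OF chi'.unit_character_axioms] E_in_U') auto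
      qed
    qed
    then obtain v where v: "v \<in> nottingham" "\<And>f. f \<in> U 1 \<Longrightarrow> psi f = nottingham_act v chi' f"
      by blast
    show ?thesis
    proof (intro bexI ballI)
      show "psi f = nottingham_act (fps_compose v w) chi f" if "f \<in> U 1" for f
        using v(2)[OF that] nottingham_act_act[OF v(1) w] by (simp add: chi'_def)
    qed (rule nottingham_compose[OF v(1) w])
  qed
qed

end

section \<open>The indicator and its invariance\<close>

text \<open>The last indicator entry in its generic form. It also covers \<open>p\<close> dividing
  \<open>m\<close>: raising to the power \<open>p\<close> is the identity on the prime field, and
  then \<open>coeff_a chi m = coeff_x chi 2\<close> for characters of this type.\<close>

definition reduced_ind :: "nat \<Rightarrow> ('p::prime_card mod_ring fps \<Rightarrow> int) \<Rightarrow> 'p mod_ring" where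
  "reduced_ind m chi = coeff_x chi 1 / coeff_x chi 2
     - coeff_a chi (m - 1) / (of_nat (m - 1) * coeff_a chi m)"

lemma of_nat_pred_nonzero:
  assumes "1 < m" "m mod CARD('p) \<noteq> 1"
  shows "(of_nat (m - 1) :: 'p::prime_card mod_ring) \<noteq> 0"
proof
  assume "(of_nat (m - 1) :: 'p mod_ring) = 0"
  then have "CARD('p) dvd m - 1" by (rule of_nat_0_mod_ring_dvd)
  then have "m mod CARD('p) = 1 mod CARD('p)"
    using assms(1) by (metis less_imp_le mod_eq_dvd_iff_nat)
  with assms(2) show False
    using prime_gt_1_nat[OF prime_card[where 'a = 'p]] by simp
qed

text \<open>When \<open>p\<close> divides \<open>m\<close>, we have \<open>a\<^sub>m = x\<^sub>2\<close>, because \<open>E\<^sub>2\<^sup>p = E\<^sub>m\<close>.\<close>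

lemma ind_eq_iff:
  fixes chi psi :: "'p::prime_card mod_ring fps \<Rightarrow> int"
  assumes chi: "break_character m chi" and psi: "break_character m psi"
    and m: "upper_break chi 1 = m" "upper_break psi 1 = m"
  shows "ind psi = ind chi \<longleftrightarrow> coeff_x psi 2 = coeff_x chi 2 \<and> coeff_a psi m = coeff_a chi m \<and>
    (m mod CARD('p) \<noteq> 1 \<longrightarrow> reduced_ind m psi = reduced_ind m chi)"
proof -
  have pow: "a ^ CARD('p) = a" for a :: "'p mod_ring"
    using finite_field_power_card_eq_same[of a] by simp
  show ?thesis
  proof (cases "CARD('p) dvd m")
    case True
    then show ?thesis
      using break_character.coeff_a_m_eq_coeff_x[OF chi True]
        break_character.coeff_a_m_eq_coeff_x[OF psi True]
      unfolding ind_def m by (auto simp: Let_def pow reduced_ind_def)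
  next
    case False
    then show ?thesis
      unfolding ind_def m by (auto simp: Let_def reduced_ind_def)
  qed
qed

text \<open>Both quotients grow by \<open>z $ 1\<close>, so their difference is unchanged; the
  condition on \<open>m\<close> makes \<open>m - 1\<close> invertible.\<close>

lemma reduced_ind_act:
  assumes chi: "break_character m chi" and z: "z \<in> U 1" and m: "m mod CARD('p) \<noteq> 1"
  shows "reduced_ind m (nottingham_act (fps_X * z) chi) =
           (reduced_ind m chi :: 'p::prime_card mod_ring)"
proof -
  interpret break_character m chi by fact
  have nz: "(of_nat (m - 1) :: 'p mod_ring) \<noteq> 0"
    using m m_ge_6 by (intro of_nat_pred_nonzero) auto
  have "(coeff_x chi 1 + z $ 1 * coeff_x chi 2) / coeff_x chi 2
      = coeff_x chi 1 / coeff_x chi 2 + z $ 1"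
    using coeff_x_2_nonzero by (simp add: add_divide_distrib del: One_nat_def)
  moreover have "(coeff_a chi (m - 1) + of_nat (m - 1) * z $ 1 * coeff_a chi m) /
        (of_nat (m - 1) * coeff_a chi m)
      = coeff_a chi (m - 1) / (of_nat (m - 1) * coeff_a chi m) + z $ 1"
  proof -
    have "of_nat (m - 1) * z $ 1 * coeff_a chi m = z $ 1 * (of_nat (m - 1) * coeff_a chi m)"
      by (simp only: mult_ac)
    moreover have "of_nat (m - 1) * coeff_a chi m \<noteq> 0"
      using nz coeff_a_m_nonzero by (simp only: mult_eq_0_iff) simp
    ultimately show ?thesis
      by (simp only: add_divide_distrib nonzero_mult_div_cancel_right not_False_eq_True)
  qed
  ultimately show ?thesis
    unfolding reduced_ind_def coeff_act[OF z] by (simp only: add_diff_cancel_right)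
qed

section \<open>From break sequences to \<open>break_character\<close>\<close>

text \<open>The value \<open>p ^ j\<close> is nonzero while the character vanishes on
  \<open>U N\<close>, so the set defining the break is bounded by \<open>N\<close>; it contains 1
  because of \<open>z\<close>. Hence the maximum exists.\<close>

lemma upper_break_char:
  fixes chi :: "'p::prime_card mod_ring fps \<Rightarrow> int"
  assumes N: "\<forall>f\<in>U N. chi f = 0"
    and z: "z \<in> U 1" "chi z = int CARD('p) ^ j"
  shows "1 \<le> upper_break chi j" "\<exists>z\<in>U (upper_break chi j). chi z = int CARD('p) ^ j"
    and "\<And>b f. upper_break chi j < b \<Longrightarrow> f \<in> U b \<Longrightarrow> chi f \<noteq> int CARD('p) ^ j"
proof -
  let ?P = "\<lambda>b. 1 \<le> b \<and> (\<exists>z\<in>U b. chi z = int CARD('p) ^ j)"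
  have bound: "b \<le> N" if "?P b" for b
  proof (rule ccontr)
    assume "\<not> b \<le> N"
    with that N U_antimono[of N b] have "int CARD('p) ^ j = 0" by force
    then show False by simp
  qed
  have "?P 1" using z by auto
  from GreatestI_nat[of ?P, OF this bound]
  show "1 \<le> upper_break chi j" "\<exists>z\<in>U (upper_break chi j). chi z = int CARD('p) ^ j"
    by (simp_all only: upper_break_def)
  show "chi f \<noteq> int CARD('p) ^ j" if b: "upper_break chi j < b" "f \<in> U b" for b f
  proof
    assume "chi f = int CARD('p) ^ j"
    with b have "?P b" by auto
    from Greatest_le_nat[of ?P, OF this bound] b(1) show False
      by (simp add: upper_break_def)
  qed
qed

text \<open>The target is discrete, so the character is 0 on a ball around 1; distances are governed
  by the order of \<open>f - 1\<close>, so the ball contains some \<open>U N\<close>.\<close>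

lemma continuous_zero_on_U:
  fixes chi :: "'p::prime_card mod_ring fps \<Rightarrow> int"
  assumes "continuous_on (U 1) chi" and one: "chi 1 = 0"
  shows "\<exists>N. \<forall>f\<in>U N. chi f = 0"
proof -
  have "(chi \<longlongrightarrow> chi 1) (at 1 within U 1)"
    using assms(1) one_in_U[of 1] unfolding continuous_on_def by blast
  then have "\<forall>\<^sub>F f in at 1 within U 1. chi f \<in> {0}"
    by (rule topological_tendstoD) (simp_all add: one open_discrete)
  then obtain d where d: "0 < d" "\<And>f. f \<in> U 1 \<Longrightarrow> f \<noteq> 1 \<Longrightarrow> dist f 1 < d \<Longrightarrow> chi f = 0"
    unfolding eventually_at by auto
  obtain N where N: "inverse (2 ^ N) < d"
    using real_arch_pow_inv[OF d(1), of "1/2"] by (auto simp: power_one_over inverse_eq_divide)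
  have "chi f = 0" if f: "f \<in> U (Suc N)" for f
  proof (cases "f = 1")
    case False
    obtain v where v: "f - 1 = fps_X ^ Suc N * v" using f by (auto simp: U_def)
    with False have "v \<noteq> 0" by auto
    then have "N \<le> subdegree (f - 1)" by (simp only: v) simp
    then have "inverse (2 ^ subdegree (f - 1)) \<le> (inverse (2 ^ N) :: real)"
      by (intro le_imp_inverse_le power_increasing) auto
    then have "dist f 1 \<le> inverse (2 ^ N)" by (simp only: dist_fps_def False if_False)
    with N have "dist f 1 < d" by simp
    moreover have "f \<in> U 1" using f by (rule U_antimono[rotated]) simp
    ultimately show ?thesis using False by (intro d(2))
  qed (simp add: one)
  then show ?thesis by blast
qed

text \<open>Breaks speak only of the exact values 1 and \<open>p\<close>. If a unit beyond a break
  had a value prime to \<open>p\<close>, respectively nonzero, a power of it at the same depth would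
  take the value 1, respectively \<open>p\<close>, against maximality.\<close>

lemma of_type_break_character:
  fixes chi :: "'p::prime_card mod_ring fps \<Rightarrow> int"
  assumes "of_type [2, m] chi"
  shows "break_character m chi" and "upper_break chi 1 = m"
proof -
  let ?p = "int CARD('p)"
  have p: "1 < ?p" using prime_gt_1_int[OF prime_card_int[where 'a = 'p]] .
  have hom: "chi \<in> hom U1_group (add_monoid (residue_ring (?p\<^sup>2)))"
    and cont: "continuous_on (U 1) chi"
    and surj: "chi ` U 1 = {0..?p\<^sup>2 - 1}"
    and b: "upper_break chi 0 = 2" "upper_break chi 1 = m"
    using assms
    by (simp_all add: of_type_def character_def break_sequence_def residue_ring_def numeral_2_eq_2)
  show "upper_break chi 1 = m" by (rule b(2))
  interpret unit_character chi
  proof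
    fix f :: "'p mod_ring fps" assume "f \<in> U 1"
    then show "0 \<le> chi f \<and> chi f < ?p\<^sup>2" using surj by force
  next
    fix f g :: "'p mod_ring fps" assume "f \<in> U 1" "g \<in> U 1"
    then have "chi (f * g) = (chi f + chi g) mod ?p\<^sup>2"
      using hom by (simp add: hom_def U1_group_def residue_ring_def)
    then show "[chi (f * g) = chi f + chi g] (mod ?p\<^sup>2)" by (simp add: cong_def)
  qed
  obtain N where N: "\<forall>f\<in>U N. chi f = 0"
    using continuous_zero_on_U[OF cont one] by blast
  have p2: "?p < ?p\<^sup>2" using p by (simp add: power2_eq_square)
  then have "?p ^ 0 \<in> chi ` U 1" "?p ^ 1 \<in> chi ` U 1"
    unfolding surj using p by auto
  then obtain u v where uv: "u \<in> U 1" "chi u = ?p ^ 0" "v \<in> U 1" "chi v = ?p ^ 1"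
    by (metis imageE)
  note break0 = upper_break_char[OF N uv(1,2), unfolded b(1)]
  note break1 = upper_break_char[OF N uv(3,4), unfolded b(2)]
  show "break_character m chi"
  proof
    fix f :: "'p mod_ring fps" assume f: "f \<in> U 3"
    then have f1: "f \<in> U 1" by (rule U_antimono[rotated]) simp
    show "?p dvd chi f"
    proof (rule ccontr)
      assume "\<not> ?p dvd chi f"
      then obtain n where "chi (f ^ n) = 1"
        using power_eq_if_coprime[OF f1, of 1] p p2 by auto
      then show False using break0(3)[OF _ U_power[OF f]] by simp
    qed
  next
    fix f :: "'p mod_ring fps" assume f: "f \<in> U (Suc m)"
    then have f1: "f \<in> U 1" by (rule U_antimono[rotated]) simp
    show "chi f = 0"
    proof (rule ccontr)
      assume "chi f \<noteq> 0"
      then obtain n where "chi (f ^ n) = ?p"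
        using power_eq_card[OF f1] by auto
      then show False using break1(3)[OF _ U_power[OF f]] by simp
    qed
  next
    \<comment> \<open>The witness of the first break has value 1 and its remainder in
      \<open>U 3\<close> a multiple of \<open>p\<close>, so the contribution of \<open>E 2\<close>
      must be prime to \<open>p\<close>.\<close>
    obtain z where z: "z \<in> U 2" "chi z = 1" using break0(2) by auto
    obtain n g where g: "g \<in> U 3" "[chi z = int n * chi (E 2) + chi g] (mod ?p\<^sup>2)"
      using decompose[OF _ z(1)] by (auto simp: numeral_eq_Suc)
    have "?p dvd chi g"
    proof (rule ccontr)
      assume "\<not> ?p dvd chi g"
      moreover have "g \<in> U 1" using g(1) by (rule U_antimono[rotated]) simp
      ultimately obtain n where "chi (g ^ n) = 1"
        using power_eq_if_coprime[of g 1] p p2 by auto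
      then show False using break0(3)[OF _ U_power[OF g(1)]] by simp
    qed
    moreover have "[chi z = int n * chi (E 2) + chi g] (mod ?p)"
      by (rule cong_dvd_modulus[OF g(2)]) simp
    ultimately show "\<not> ?p dvd chi (E 2)"
      using z(2) p by (auto dest: cong_dvd_iff)
  next
    \<comment> \<open>For the second break the remainder contributes 0, so \<open>E m\<close> alone
      accounts for the value \<open>p\<close>.\<close>
    obtain z where z: "z \<in> U m" "chi z = ?p" using break1(2) by auto
    obtain n g where g: "g \<in> U (Suc m)" "[chi z = int n * chi (E m) + chi g] (mod ?p\<^sup>2)"
      using decompose[OF break1(1) z(1)] by auto
    have "chi g = 0"
    proof (rule ccontr)
      assume "chi g \<noteq> 0"
      moreover have "g \<in> U 1" using g(1) by (rule U_antimono[rotated]) simp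
      ultimately obtain n where "chi (g ^ n) = ?p"
        using power_eq_card by auto
      then show False using break1(3)[OF _ U_power[OF g(1)]] by simp
    qed
    then show "chi (E m) \<noteq> 0"
      using g(2) z(2) p p2 by (auto simp: cong_def)
  qed
qed

section \<open>Classification by the indicator\<close>

theorem theorem6p1:
  fixes chi psi :: "'p::prime_card mod_ring fps \<Rightarrow> int" and m :: nat
  assumes "of_type [2, m] chi" and "of_type [2, m] psi"
  shows "weakly_equivalent chi psi \<longleftrightarrow> ind psi = ind chi"
proof -
  interpret chi: break_character m chi by (rule of_type_break_character[OF assms(1)])
  interpret psi: break_character m psi by (rule of_type_break_character[OF assms(2)])
  note ind = ind_eq_iff[OF chi.break_character_axioms psi.break_character_axioms
      of_type_break_character(2)[OF assms(1)] of_type_break_character(2)[OF assms(2)]]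
  have m: "6 \<le> m" by (rule chi.m_ge_6)
  show ?thesis
  proof
    assume "weakly_equivalent chi psi"
    then obtain z where z: "z \<in> U 1" "\<And>f. f \<in> U 1 \<Longrightarrow> psi f = nottingham_act (fps_X * z) chi f"
      by (auto simp: weakly_equivalent_def nottingham_def)
    \<comment> \<open>Weak equivalence gives equality only on \<open>U 1\<close>, but the
      coefficients depend only on values at the \<open>E j\<close>, which lie there.\<close>
    have "psi (E j) = nottingham_act (fps_X * z) chi (E j)" if "1 \<le> j" for j
      by (rule z(2)[OF E_in_U'[OF that]])
    then have eq: "coeff_x psi j = coeff_x (nottingham_act (fps_X * z) chi) j"
        "coeff_a psi j = coeff_a (nottingham_act (fps_X * z) chi) j" if "1 \<le> j" for j
      using that by (simp_all add: coeff_x_def coeff_a_def)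
    have "reduced_ind m psi = reduced_ind m (nottingham_act (fps_X * z) chi)"
      using m by (simp add: reduced_ind_def eq)
    then show "ind psi = ind chi"
      unfolding ind using m chi.coeff_act[OF z(1)] eq[of 2] eq[of m]
        reduced_ind_act[OF chi.break_character_axioms z(1)]
      by simp
  next
    assume "ind psi = ind chi"
    then have ind: "coeff_x psi 2 = coeff_x chi 2" "coeff_a psi m = coeff_a chi m"
        "m mod CARD('p) \<noteq> 1 \<Longrightarrow> reduced_ind m psi = reduced_ind m chi"
      unfolding ind by auto
    \<comment> \<open>Substitution adds \<open>c * coeff_x chi 2\<close> to the first coefficient;
      this \<open>c\<close> makes it equal to that of \<open>psi\<close>.\<close>
    define c where "c = (coeff_x psi 1 - coeff_x chi 1) / coeff_x chi 2"
    define z where "z = 1 + fps_X * fps_const c"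
    have z: "z \<in> U 1" "z $ 1 = c" by (auto simp: z_def U_iff_ex)
    define w where "w = fps_X * z"
    have w: "w \<in> nottingham" using z by (auto simp: w_def nottingham_def)
    define chi' where "chi' = nottingham_act w chi"
    interpret chi': break_character m chi'
      unfolding chi'_def by (rule chi.break_character_act[OF w])
    note act = chi.coeff_act[OF z(1), folded w_def chi'_def]
    have x1: "coeff_x psi 1 = coeff_x chi' 1"
      unfolding act z(2) using chi.coeff_x_2_nonzero by (simp add: c_def)
    have x2: "coeff_x psi 2 = coeff_x chi' 2"
      unfolding act by (rule ind(1))
    have am: "coeff_a psi m = coeff_a chi' m"
      unfolding act by (rule ind(2))
    have mod_p: "[psi (E j) = chi' (E j)] (mod int CARD('p))" if "1 \<le> j" for j
    proof -
      consider "j = 1" | "j = 2" | "3 \<le> j" using \<open>1 \<le> j\<close> by linarith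
      then show ?thesis
      proof cases
        case 3
        then have "int CARD('p) dvd psi (E j)" "int CARD('p) dvd chi' (E j)"
          by (auto intro: psi.dvd_U3 chi'.dvd_U3 E_in_U')
        then show ?thesis by (simp add: cong_def mod_eq_0_iff_dvd)
      qed (use x1 x2 chi'.coeff_x_eq_iff in blast)+
    qed
    have "psi (E j) = chi' (E j)" if "m - 2 < j" for j
    proof -
      \<comment> \<open>Only \<open>m\<close> and \<open>m - 1\<close> lie below the vanishing
        range. If \<open>m\<close> is 1 modulo \<open>p\<close>, then \<open>E (m - 1)\<close> is a
        \<open>p\<close>-th power and needs only agreement modulo \<open>p\<close>; otherwise the
        last indicator entry decides.\<close>
      consider "m < j" | "j = m" | "j = m - 1" "CARD('p) dvd m - 1"
        | "j = m - 1" "m mod CARD('p) \<noteq> 1"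
        using \<open>m - 2 < j\<close> m mod_eq_dvd_iff_nat[of 1 m "CARD('p)"]
          prime_gt_1_nat[OF prime_card[where 'a = 'p]] by fastforce
      then show ?thesis
      proof cases
        case 1
        then have "E j \<in> (U (Suc m) :: 'p mod_ring fps set)" by (intro E_in_U') simp
        then show ?thesis by (simp add: psi.zero_U chi'.zero_U)
      next
        case 2
        then show ?thesis
          using m am by (intro chi'.coeff_a_eqD[OF psi.break_character_axioms]) auto
      next
        case 3
        then show ?thesis
          using m mod_p by (intro chi'.E_eq_if_card_dvd[OF psi.break_character_axioms]) auto
      next
        case 4
        \<comment> \<open>All other coefficients in this expression already match and the
          denominators are nonzero, so equality forces the coefficients at \<open>m - 1\<close> to
          agree.\<close>
        have "reduced_ind m psi = reduced_ind m chi'"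
          using ind(3) reduced_ind_act[OF chi.break_character_axioms z(1)] 4(2)
          by (simp add: chi'_def w_def)
        moreover have "(of_nat (m - 1) :: 'p mod_ring) \<noteq> 0"
          using m 4(2) by (intro of_nat_pred_nonzero) auto
        ultimately have "coeff_a psi (m - 1) = coeff_a chi' (m - 1)"
          using chi'.coeff_a_m_nonzero unfolding reduced_ind_def x1 x2 am
          by (simp del: of_nat_diff)
        then show ?thesis
          using m 4(1) by (intro chi'.coeff_a_eqD[OF psi.break_character_axioms]) auto
      qed
    qed
    \<comment> \<open>The start \<open>s = m - 2\<close> is the largest allowed; the indices above
      it were just settled.\<close>
    then have "\<exists>v\<in>nottingham. \<forall>f\<in>U 1. psi f = nottingham_act v chi' f"
      using m mod_p
      by (intro chi'.conjugate_if_agree_above[OF psi.break_character_axioms, of "m - 2"]) simp_all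
    then obtain v where v: "v \<in> nottingham" "\<And>f. f \<in> U 1 \<Longrightarrow> psi f = nottingham_act v chi' f"
      by blast
    have "psi f = nottingham_act (fps_compose v w) chi f" if "f \<in> U 1" for f
      using v(2)[OF that] nottingham_act_act[OF v(1) w] by (simp add: chi'_def)
    then show "weakly_equivalent chi psi"
      unfolding weakly_equivalent_def using nottingham_compose[OF v(1) w] by blast
  qed
qed

end
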